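(* Let $S\subset\mathbb{R}$ contain all terms of a lacunary sequence $(b_i)_{i\ge1}\subset(0,\infty)$ with $-\log b_i=O(i)$. Then for every infinite set $A\subset\mathbb{R}$, the sets $S+A$ and $S-A$ are not measure universal. In particular, $\{2^{-n}: n\ge1\}+A$ is not measure universal for any infinite $A\subset\mathbb{R}$.
   Context: A set $E\subset\mathbb{R}$ is measure universal if for every Lebesgue measurable $L\subset\mathbb{R}$ of positive Lebesgue measure there exist $x\in\mathbb{R}$ and $\lambda\neq0$ with $x+\lambda E\subset L$. A sequence $(b_i)_{i\ge1}\subset(0,\infty)$ is lacunary with ratio $q\in(0,1)$ if $b_{i+1}\le q\,b_i$ for all $i$; it is lacunary if this holds for some $q\in(0,1)$. $S\pm A=\{s\pm a: s\in S,\ a\in A\}$. The condition $-\log b_i=O(i)$ means there are $C>0$ and $i_0$ with $-\log b_i\le Ci$ for all $i\ge i_0$. *)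

theory Defs
  imports "HOL-Analysis.Analysis" "HOL-Library.Set_Algebras"
begin

definition measure_universal :: "real set \<Rightarrow> bool" where
  "measure_universal E \<longleftrightarrow>
     (\<forall>L \<in> sets lebesgue. emeasure lebesgue L > 0 \<longrightarrow>
        (\<exists>x c. c \<noteq> 0 \<and> (\<lambda>e. x + c * e) ` E \<subseteq> L))"

text \<open>Sequences are indexed by \<open>i \<ge> 1\<close>; the value of \<open>b\<close> at \<open>0\<close> is never used.\<close>

definition lacunary_with_ratio :: "real \<Rightarrow> (nat \<Rightarrow> real) \<Rightarrow> bool" where
  "lacunary_with_ratio q b \<longleftrightarrow>
     0 < q \<and> q < 1 \<and> (\<forall>i\<ge>1. b i > 0) \<and> (\<forall>i\<ge>1. b (i + 1) \<le> q * b i)"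

definition lacunary :: "(nat \<Rightarrow> real) \<Rightarrow> bool" where
  "lacunary b \<longleftrightarrow> (\<exists>q. lacunary_with_ratio q b)"

text \<open>The condition \<open>- log b\<^sub>i = O(i)\<close>, read as a one-sided bound.\<close>

definition neg_log_linear :: "(nat \<Rightarrow> real) \<Rightarrow> bool" where
  "neg_log_linear b \<longleftrightarrow> (\<exists>C>0. \<exists>i0\<ge>1. \<forall>i\<ge>i0. - ln (b i) \<le> C * real i)"

text \<open>
  The sum set of \<open>S\<close> and \<open>A\<close> is \<open>S + A\<close> from \<open>Set_Algebras\<close>. The notation \<open>S - A\<close> means
  set-theoretic complement, so the set of differences gets its own name.
\<close>

definition diff_set :: "real set \<Rightarrow> real set \<Rightarrow> real set" where
  "diff_set S A = {s - a | s a. s \<in> S \<and> a \<in> A}"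

end

theory Submission
  imports Defs
begin

text \<open>
  Take \<open>k\<close> points of \<open>A\<close> and \<open>n\<close> consecutive terms of \<open>b\<close> that are small compared with the gaps
  between these points. Their \<open>N = k n\<close> sums are separated by some \<open>g\<close> with \<open>ln (1 / g) \<le> C n + O\<^sub>k(1)\<close>,
  so \<open>ln (1 / g) / N\<close> becomes arbitrarily small for large \<open>k\<close> and \<open>n\<close>.
  Such a separated set \<open>F\<close> can be avoided (Kolountzakis): after rounding to a grid of mesh
  \<open>1 / M\<close> with \<open>M\<close> of order \<open>1 / g\<close>, the copies \<open>x + c F\<close> inside \<open>{0..1}\<close> with \<open>c\<close> in a fixed
  range fall into \<open>O(M\<^sup>2)\<close> patterns, each occupying \<open>N\<close> of \<open>O(M)\<close> cells. The greedy algorithm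
  meets all patterns with \<open>O(M ln M / N + 1)\<close> cells, hence with a set of small measure.
  Removing such sets for an exhausting sequence of ranges of \<open>c\<close> leaves positive measure.
\<close>

section \<open>Greedy hitting sets for finite families\<close>

text \<open>Double counting of the incidences \<open>x \<in> P t\<close>: there are at least
  \<open>N * card T\<close> of them, so some \<open>x\<close> attains the average over
  \<open>X\<close>.\<close>

lemma exists_frequent_point:
  fixes P :: "'t \<Rightarrow> 'x set"
  assumes "finite X" "finite T" "T \<noteq> {}" and P: "\<And>t. t \<in> T \<Longrightarrow> P t \<subseteq> X \<and> N \<le> card (P t)" and "0 < N"
  shows "\<exists>x\<in>X. real N / real (card X) * real (card T) \<le> real (card {t\<in>T. x \<in> P t})"
proof (rule ccontr)
  assume neg: "\<not> ?thesis"
  obtain t where "t \<in> T" using \<open>T \<noteq> {}\<close> by blast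
  with P \<open>0 < N\<close> have "X \<noteq> {}" by (metis card.empty not_le subset_empty)
  have "real N * real (card T) \<le> (\<Sum>t\<in>T. real (card (P t)))"
    using sum_bounded_below[of T "real N" "\<lambda>t. real (card (P t))"] P by (simp add: mult.commute)
  also have "\<dots> = (\<Sum>t\<in>T. \<Sum>x\<in>X. of_bool (x \<in> P t))"
  proof (rule sum.cong)
    fix t assume "t \<in> T"
    then have "P t = {x\<in>X. x \<in> P t}" using P by blast
    then show "real (card (P t)) = (\<Sum>x\<in>X. of_bool (x \<in> P t))"
      using \<open>finite X\<close> by (simp add: sum.If_cases of_bool_def Int_def)
  qed simp
  also have "\<dots> = (\<Sum>x\<in>X. \<Sum>t\<in>T. of_bool (x \<in> P t))" by (rule sum.swap)
  also have "\<dots> = (\<Sum>x\<in>X. real (card {t\<in>T. x \<in> P t}))"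
    using \<open>finite T\<close> by (simp add: sum.If_cases of_bool_def Int_def)
  also have "\<dots> < (\<Sum>x\<in>X. real N / real (card X) * real (card T))"
    using neg by (intro sum_strict_mono assms \<open>X \<noteq> {}\<close>) (auto simp: not_le)
  also have "\<dots> = real N * real (card T)"
    using \<open>X \<noteq> {}\<close> \<open>finite X\<close> by simp
  finally show False by simp
qed

text \<open>Each round adds a point that is frequent among the patterns still missed, which
  multiplies their number by at most \<open>1 - N / card X\<close>.\<close>

lemma greedy_hitting:
  fixes P :: "'t \<Rightarrow> 'x set"
  assumes "finite X" "finite T" "T \<noteq> {}" and P: "\<And>t. t \<in> T \<Longrightarrow> P t \<subseteq> X \<and> N \<le> card (P t)" and "0 < N"
  shows "\<exists>H\<subseteq>X. card H \<le> R \<and>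
    real (card {t\<in>T. P t \<inter> H = {}}) \<le> real (card T) * (1 - real N / real (card X)) ^ R"
proof (induction R)
  case 0
  show ?case by (intro exI[of _ "{}"]) simp
next
  case (Suc R)
  let ?p = "real N / real (card X)"
  from Suc obtain H where H: "H \<subseteq> X" "card H \<le> R"
    and le: "real (card {t\<in>T. P t \<inter> H = {}}) \<le> real (card T) * (1 - ?p) ^ R" by blast
  obtain t where "t \<in> T" using \<open>T \<noteq> {}\<close> by blast
  with P \<open>finite X\<close> have "N \<le> card X" by (meson card_mono le_trans)
  then have p: "0 \<le> 1 - ?p" using \<open>0 < N\<close> by (simp add: field_simps)
  define T' where "T' = {t\<in>T. P t \<inter> H = {}}"
  show ?case
  proof (cases "T' = {}")
    case True
    then have "real (card {t\<in>T. P t \<inter> H = {}}) \<le> real (card T) * (1 - ?p) ^ Suc R"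
      unfolding T'_def[symmetric] using p by simp
    with H show ?thesis by (intro exI[of _ H]) auto
  next
    case False
    have "finite T'" using \<open>finite T\<close> by (simp add: T'_def)
    have "\<exists>x\<in>X. ?p * real (card T') \<le> real (card {t\<in>T'. x \<in> P t})"
      using \<open>finite X\<close> \<open>finite T'\<close> False _ \<open>0 < N\<close>
      by (rule exists_frequent_point) (use P in \<open>auto simp: T'_def\<close>)
    then obtain x where x: "x \<in> X" "?p * real (card T') \<le> real (card {t\<in>T'. x \<in> P t})" by blast
    have "{t\<in>T. P t \<inter> insert x H = {}} = T' - {t\<in>T'. x \<in> P t}"
      by (auto simp: T'_def)
    then have "real (card {t\<in>T. P t \<inter> insert x H = {}}) = real (card T') - real (card {t\<in>T'. x \<in> P t})"
      using \<open>finite T'\<close> by (simp add: card_Diff_subset card_mono of_nat_diff)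
    also have "\<dots> \<le> (1 - ?p) * real (card T')"
      using x(2) by (simp add: algebra_simps)
    also have "\<dots> \<le> (1 - ?p) * (real (card T) * (1 - ?p) ^ R)"
      using le p unfolding T'_def by (rule mult_left_mono)
    finally have "real (card {t\<in>T. P t \<inter> insert x H = {}}) \<le> real (card T) * (1 - ?p) ^ Suc R"
      by (simp add: mult_ac)
    moreover have "card (insert x H) \<le> Suc R"
      using H(2) card_insert_le_m1[of "Suc R" H x] by simp
    ultimately show ?thesis using H(1) x(1) by (intro exI[of _ "insert x H"]) auto
  qed
qed

text \<open>Since \<open>1 - p \<le> exp (- p)\<close>, after \<open>R\<close> greedy rounds fewer
  than \<open>\<tau> * exp (- ln \<tau>) = 1\<close> patterns are missed, hence none. Upper bounds
  \<open>m\<close> and \<open>\<tau>\<close> replace the cardinalities so that only estimates have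
  to be supplied.\<close>

lemma hitting_set_exists:
  fixes P :: "'t \<Rightarrow> 'x set"
  assumes "finite X" "finite T" and P: "\<And>t. t \<in> T \<Longrightarrow> P t \<subseteq> X \<and> N \<le> card (P t)" and "0 < N"
    and "real (card X) \<le> m" "real (card T) \<le> \<tau>" and R: "m / real N * ln \<tau> < real R"
  shows "\<exists>H\<subseteq>X. card H \<le> R \<and> (\<forall>t\<in>T. P t \<inter> H \<noteq> {})"
proof (cases "T = {}")
  case False
  obtain t where "t \<in> T" using False by blast
  with P \<open>finite X\<close> have "N \<le> card X" by (meson card_mono le_trans)
  with \<open>0 < N\<close> have cX: "0 < real (card X)" by linarith
  have "1 \<le> card T" using False \<open>finite T\<close> by (simp add: Suc_le_eq card_gt_0_iff)
  then have cT: "1 \<le> \<tau>" using assms(6) by linarith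
  let ?p = "real N / real (card X)"
  obtain H where H: "H \<subseteq> X" "card H \<le> R"
    "real (card {t\<in>T. P t \<inter> H = {}}) \<le> real (card T) * (1 - ?p) ^ R"
    using greedy_hitting[where P = P and N = N and R = R, OF \<open>finite X\<close> \<open>finite T\<close> False _ \<open>0 < N\<close>] P by blast
  have "(1 - ?p) ^ R \<le> exp (- ?p) ^ R"
    using exp_ge_add_one_self[of "- ?p"] \<open>N \<le> card X\<close> cX by (intro power_mono) auto
  also have "\<dots> = exp (- (real R * ?p))" by (simp flip: exp_of_nat_mult)
  also have "\<dots> < exp (- ln \<tau>)"
  proof -
    have "m * ln \<tau> < real R * real N" using R \<open>0 < N\<close> by (simp add: field_simps)
    moreover have "real (card X) * ln \<tau> \<le> m * ln \<tau>"
      using assms(5) cT by (intro mult_right_mono ln_ge_zero)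
    ultimately have "real (card X) * ln \<tau> < real R * real N" by linarith
    then show ?thesis using cX by (simp add: field_simps)
  qed
  also have "\<dots> = inverse \<tau>" using cT by (simp add: exp_minus)
  finally have lt: "(1 - ?p) ^ R < inverse \<tau>" .
  have "real (card T) * (1 - ?p) ^ R \<le> \<tau> * (1 - ?p) ^ R"
    using assms(6) \<open>N \<le> card X\<close> cX by (intro mult_right_mono) auto
  also have "\<dots> < \<tau> * inverse \<tau>"
    using lt cT by (intro mult_strict_left_mono) auto
  also have "\<dots> = 1" using cT by simp
  finally have "card {t\<in>T. P t \<inter> H = {}} = 0" using H(3) by simp
  then have "{t\<in>T. P t \<inter> H = {}} = {}" using \<open>finite T\<close> by simp
  with H(1,2) show ?thesis by (intro exI[of _ H]) blast
qed (auto intro!: exI[of _ "{}"])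

section \<open>Small sets meeting all copies of a separated finite set\<close>

text \<open>Rounding \<open>M * x\<close> and \<open>M * c\<close> to integers leaves finitely many
  patterns of cells, and a hitting set for them, thickened to intervals, is \<open>U\<close>. The
  bound on \<open>M\<close> keeps the points of \<open>F\<close> in distinct cells, \<open>K\<close>
  absorbs the rounding error, and \<open>B * M\<close> bounds the rounded parameters.\<close>

lemma small_set_meeting_copies:
  fixes F :: "real set" and r g D :: real
  assumes "finite F" "F \<noteq> {}" and D: "\<forall>e\<in>F. \<bar>e\<bar> \<le> D"
    and sep: "pairwise (\<lambda>e e'. g \<le> \<bar>e - e'\<bar>) F"
    and g: "0 < g" "g \<le> 1" and r: "1 \<le> r" and M: "2 * r / g \<le> real M"
    and K: "D + 2 \<le> real K" and B: "r * (D + 1) + 2 \<le> real B"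
  shows "\<exists>U. U \<in> sets lebesgue \<and>
    emeasure lebesgue U \<le> ennreal (8 * real K * (real K + 1) * ln (3 * real B * real M) / real (card F)
      + 2 * real K / real M) \<and>
    (\<forall>x c. 1 / r \<le> \<bar>c\<bar> \<and> \<bar>c\<bar> \<le> r \<and> (\<lambda>e. x + c * e) ` F \<subseteq> {0..1} \<longrightarrow> (\<lambda>e. x + c * e) ` F \<inter> U \<noteq> {})"
proof -
  obtain e0 where e0: "e0 \<in> F" using \<open>F \<noteq> {}\<close> by blast
  have D0: "0 \<le> D" using D[rule_format, OF e0] by linarith
  have N: "0 < card F" using assms(1,2) by (simp add: card_gt_0_iff)
  have "2 * 1 / 1 \<le> 2 * r / g" using g r by (intro frac_le) auto
  with M have M2: "2 \<le> real M" by linarith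
  have K2: "2 \<le> real K" using K D0 by linarith
  have "1 * 1 \<le> r * (D + 1)" using r D0 by (intro mult_mono) auto
  with B have B3: "3 \<le> real B" by linarith
  \<comment> \<open>A point of \<open>{0..1}\<close> scaled by \<open>M\<close> lies in
    \<open>{0..M}\<close>, and its cell is at most \<open>K\<close> away.\<close>
  define X where "X = {- int K..int M + int K}"
  define P where "P = (\<lambda>(i::int, j::int). (\<lambda>e. \<lfloor>of_int i + of_int j * e\<rfloor>) ` F)"
  define J where "J = {- int (B * M)..int (B * M)}"
  \<comment> \<open>Building the hypotheses of the hitting lemma into \<open>T\<close> makes it
    apply at once; that every relevant copy yields a member of \<open>T\<close> is checked
    afterwards.\<close>
  define T where "T = {t \<in> J \<times> J. P t \<subseteq> X \<and> card F \<le> card (P t)}"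
  define m where "m = 2 * (real K + 1) * real M"
  define \<tau> where "\<tau> = (3 * real B * real M)\<^sup>2"
  \<comment> \<open>The least integer above the threshold of the hitting lemma; the threshold is
    nonnegative by \<open>L0\<close>, so \<open>nat\<close> does not truncate.\<close>
  define R where "R = nat \<lfloor>m / real (card F) * ln \<tau>\<rfloor> + 1"
  have BM: "1 * 1 \<le> real B * real M" using B3 M2 by (intro mult_mono) auto
  have "1 \<le> 3 * real B * real M" using BM by simp
  then have \<tau>1: "1 \<le> \<tau>" by (simp add: \<tau>_def)
  have ln\<tau>: "ln \<tau> = 2 * ln (3 * real B * real M)"
    using B3 M2 unfolding \<tau>_def by (subst ln_realpow) auto
  have L0: "0 \<le> m / real (card F) * ln \<tau>" using \<tau>1 by (simp add: m_def)
  have cX: "real (card X) \<le> m"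
  proof -
    have "real (card X) = real M + 2 * real K + 1" by (simp add: X_def)
    moreover have "(real K + 1) * 2 \<le> (real K + 1) * real M" using M2 by (intro mult_left_mono) auto
    moreover have "2 * real M \<le> real K * real M" using K2 by (intro mult_right_mono) auto
    ultimately show ?thesis by (simp add: m_def algebra_simps)
  qed
  have cT: "real (card T) \<le> \<tau>"
  proof -
    have "card T \<le> card (J \<times> J)" unfolding T_def J_def by (intro card_mono) auto
    also have "\<dots> = (2 * (B * M) + 1)\<^sup>2" by (simp add: J_def power2_eq_square card_cartesian_product nat_add_distrib nat_mult_distrib)
    finally have "real (card T) \<le> (2 * (real B * real M) + 1)\<^sup>2"
      by (metis (mono_tags, lifting) of_nat_1 of_nat_add of_nat_le_iff of_nat_mult of_nat_numeral of_nat_power)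
    also have "\<dots> \<le> \<tau>" unfolding \<tau>_def using BM by (intro power_mono) auto
    finally show ?thesis .
  qed
  have "\<exists>H\<subseteq>X. card H \<le> R \<and> (\<forall>t\<in>T. P t \<inter> H \<noteq> {})"
  proof (rule hitting_set_exists[OF _ _ _ N cX cT])
    show "finite X" by (simp add: X_def)
    show "finite T" unfolding T_def J_def by (rule finite_Collect_conjI) simp
    show "\<And>t. t \<in> T \<Longrightarrow> P t \<subseteq> X \<and> card F \<le> card (P t)" by (simp add: T_def)
    show "m / real (card F) * ln \<tau> < real R" using L0 unfolding R_def by linarith
  qed
  then obtain H where H: "H \<subseteq> X" "card H \<le> R" "\<And>t. t \<in> T \<Longrightarrow> P t \<inter> H \<noteq> {}" by blast
  have finH: "finite H" using H(1) by (rule finite_subset) (simp add: X_def)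
  \<comment> \<open>All points whose scaled position is within the rounding error \<open>K\<close>
    of cell \<open>k\<close>.\<close>
  define I where "I = (\<lambda>k::int. {(of_int k - real K) / real M..(of_int k + real K) / real M})"
  define U where "U = (\<Union>k\<in>H. I k)"
  have U: "U \<in> sets lebesgue" unfolding U_def I_def using finH by (intro sets.finite_UN) auto
  have I: "emeasure lebesgue (I k) = ennreal (2 * real K / real M)" for k
    by (simp add: I_def divide_right_mono diff_divide_distrib[symmetric])
  have "emeasure lebesgue U \<le> (\<Sum>k\<in>H. emeasure lebesgue (I k))"
    unfolding U_def using finH by (intro emeasure_subadditive_finite) (auto simp: I_def)
  also have "\<dots> = ennreal (real (card H) * (2 * real K / real M))"
    by (simp only: I sum_constant ennreal_of_nat_eq_real_of_nat) (rule ennreal_mult[symmetric]; simp)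
  also have "\<dots> \<le> ennreal (8 * real K * (real K + 1) * ln (3 * real B * real M) / real (card F)
      + 2 * real K / real M)"
  proof (rule ennreal_leI)
    have "real (card H) \<le> m / real (card F) * ln \<tau> + 1" using H(2) L0 unfolding R_def by linarith
    then have "real (card H) * (2 * real K / real M) \<le> (m / real (card F) * ln \<tau> + 1) * (2 * real K / real M)"
      by (intro mult_right_mono) auto
    \<comment> \<open>The factor \<open>M\<close> in \<open>m\<close> cancels against the interval
      length, so in the first summand \<open>M\<close> survives only inside the logarithm.\<close>
    also have "\<dots> = 8 * real K * (real K + 1) * ln (3 * real B * real M) / real (card F) + 2 * real K / real M"
      using M2 N unfolding m_def ln\<tau> by (simp add: field_simps)
    finally show "real (card H) * (2 * real K / real M) \<le> 8 * real K * (real K + 1) * ln (3 * real B * real M) / real (card F) + 2 * real K / real M" .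
  qed
  finally have meas: "emeasure lebesgue U \<le> \<dots>" .
  have hit: "(\<lambda>e. x + c * e) ` F \<inter> U \<noteq> {}"
    if c: "1 / r \<le> \<bar>c\<bar>" "\<bar>c\<bar> \<le> r" and x: "(\<lambda>e. x + c * e) ` F \<subseteq> {0..1}" for x c
  proof -
    define i where "i = \<lfloor>real M * x\<rfloor>"
    define j where "j = \<lfloor>real M * c\<rfloor>"
    \<comment> \<open>Rounding \<open>M * x\<close> costs at most 1, rounding \<open>M * c\<close>
      at most \<open>D\<close> after multiplication by \<open>e\<close>, and the outer floor at most
      1; \<open>D + 2 \<le> K\<close> covers the sum.\<close>
    have near: "\<bar>real M * (x + c * e) - of_int \<lfloor>of_int i + of_int j * e\<rfloor>\<bar> \<le> real K" if "e \<in> F" for e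
    proof -
      have "\<bar>real M * x - of_int i\<bar> \<le> 1" unfolding i_def by linarith
      moreover have "\<bar>real M * c - of_int j\<bar> \<le> 1" unfolding j_def by linarith
      then have "\<bar>(real M * c - of_int j) * e\<bar> \<le> 1 * D" unfolding abs_mult using D[rule_format, OF that] by (intro mult_mono) auto
      moreover define y where "y = of_int i + of_int j * e"
      moreover have "\<bar>y - of_int \<lfloor>y\<rfloor>\<bar> \<le> 1" by linarith
      moreover have "real M * (x + c * e) = (real M * x - of_int i) + (real M * c - of_int j) * e + y"
        by (simp add: y_def algebra_simps)
      ultimately show ?thesis using K unfolding y_def[symmetric] by linarith
    qed
    have "P (i, j) \<subseteq> X"
    proof
      fix k assume "k \<in> P (i, j)"
      then obtain e where e: "e \<in> F" and k: "k = \<lfloor>of_int i + of_int j * e\<rfloor>" by (auto simp: P_def)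
      then have "0 \<le> x + c * e" "x + c * e \<le> 1" using x by auto
      then have "0 \<le> real M * (x + c * e)" "real M * (x + c * e) \<le> real M * 1"
        using M2 by (auto intro: mult_left_mono)
      with near[OF e] show "k \<in> X" unfolding X_def k[symmetric] by simp linarith
    qed
    moreover have "card F \<le> card (P (i, j))"
    proof -
      \<comment> \<open>Here \<open>\<bar>j\<bar> \<ge> M * \<bar>c\<bar> - 1 \<ge> 2 / g - 1 \<ge>
        1 / g\<close>, so multiplication by \<open>j\<close> spreads \<open>F\<close> to gaps of at
        least 1 and the floors are distinct.\<close>
      have "real M * (1 / r) \<le> real M * \<bar>c\<bar>" using c by (intro mult_left_mono) auto
      moreover have "2 / g \<le> real M * (1 / r)" using M r g by (simp add: field_simps)
      moreover have "real M * \<bar>c\<bar> - 1 \<le> \<bar>of_int j\<bar>" 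
      proof -
        have "\<bar>real M * c - of_int j\<bar> \<le> 1" unfolding j_def by linarith
        moreover have "\<bar>real M * c\<bar> = real M * \<bar>c\<bar>" by (simp add: abs_mult)
        ultimately show ?thesis by linarith
      qed
      moreover have "1 \<le> 1 / g" using g by simp
      ultimately have "1 / g \<le> \<bar>of_int j\<bar>" by simp
      then have jg: "1 \<le> \<bar>of_int j\<bar> * g" using g by (simp add: field_simps)
      have "inj_on (\<lambda>e. \<lfloor>of_int i + of_int j * e\<rfloor>) F"
      proof (rule inj_onI, rule ccontr)
        fix e e' assume e: "e \<in> F" "e' \<in> F" "e \<noteq> e'"
          and eq: "\<lfloor>of_int i + of_int j * e\<rfloor> = \<lfloor>of_int i + of_int j * e'\<rfloor>"
        have "\<bar>of_int j\<bar> * g \<le> \<bar>of_int j\<bar> * \<bar>e - e'\<bar>" using pairwiseD[OF sep e] by (intro mult_left_mono) auto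
        also have "\<dots> = \<bar>(of_int i + of_int j * e) - (of_int i + of_int j * e')\<bar>"
          by (simp flip: abs_mult add: algebra_simps)
        also have "\<dots> < 1" using eq by linarith
        finally show False using jg by simp
      qed
      then show ?thesis by (simp add: P_def card_image)
    qed
    moreover have "(i, j) \<in> J \<times> J"
    proof -
      \<comment> \<open>One point of the copy in \<open>{0..1}\<close> already bounds
        \<open>x\<close>. Both \<open>x\<close> and \<open>c\<close> stay below
        \<open>B - 1\<close>; the spare unit pays for the floor after scaling by
        \<open>M\<close>.\<close>
      have "\<bar>c * e0\<bar> \<le> r * D" unfolding abs_mult using c D[rule_format, OF e0] by (intro mult_mono) auto
      moreover have "0 \<le> x + c * e0" "x + c * e0 \<le> 1" using x e0 by auto
      ultimately have "\<bar>x\<bar> \<le> 1 + r * D" by linarith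
      then have x1: "\<bar>x\<bar> \<le> real B - 1" using B r by (simp add: algebra_simps)
      have "0 \<le> r * D" using r D0 by simp
      then have c1: "\<bar>c\<bar> \<le> real B - 1" using B c by (simp add: algebra_simps)
      have bound: "\<lfloor>real M * y\<rfloor> \<in> J" if "\<bar>y\<bar> \<le> real B - 1" for y
      proof -
        have "real M * \<bar>y\<bar> \<le> real M * (real B - 1)" using that by (intro mult_left_mono) auto
        then have "\<bar>real M * y\<bar> \<le> real M * real B - real M" by (simp add: abs_mult algebra_simps)
        then have "\<bar>of_int \<lfloor>real M * y\<rfloor>\<bar> \<le> real M * real B" using M2 by linarith
        then have "\<bar>\<lfloor>real M * y\<rfloor>\<bar> \<le> int M * int B"
          by (metis (mono_tags, lifting) of_int_abs of_int_le_iff of_int_mult of_int_of_nat_eq)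
        then show ?thesis by (auto simp: J_def mult.commute)
      qed
      show ?thesis using bound[OF x1] bound[OF c1] by (simp add: i_def j_def)
    qed
    ultimately have "(i, j) \<in> T" by (simp add: T_def)
    from H(3)[OF this] obtain e where e: "e \<in> F" "\<lfloor>of_int i + of_int j * e\<rfloor> \<in> H"
      unfolding P_def by auto
    have "x + c * e \<in> I \<lfloor>of_int i + of_int j * e\<rfloor>"
    proof -
      define k where "k = \<lfloor>of_int i + of_int j * e\<rfloor>"
      define y where "y = x + c * e"
      have "\<bar>real M * y - of_int k\<bar> \<le> real K" using near[OF e(1)] by (simp add: k_def y_def)
      then have "of_int k - real K \<le> y * real M" "y * real M \<le> of_int k + real K"
        by (auto simp: mult.commute)
      then show ?thesis using M2 unfolding I_def k_def[symmetric] y_def[symmetric]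
        by (simp add: divide_le_eq le_divide_eq)
    qed
    with e show ?thesis by (auto simp: U_def)
  qed
  show ?thesis using U meas hit by blast
qed

section \<open>From finely populated sets to failure of measure universality\<close>

text \<open>The main condition is that \<open>ln (1 / g)\<close> is negligible against the number of
  points. The condition \<open>g \<le> \<eta>\<close> makes the grid fine, and
  \<open>1 \<le> \<eta> * card F\<close> lets additive constants be absorbed into multiples of
  \<open>\<eta> * card F\<close>.\<close>

definition finely_populated :: "real set \<Rightarrow> bool" where
  "finely_populated E \<longleftrightarrow> (\<forall>\<eta>>0. \<exists>F g. finite F \<and> F \<noteq> {} \<and> F \<subseteq> E \<and> 0 < g \<and> g \<le> \<eta> \<and>
    pairwise (\<lambda>e e'. g \<le> \<bar>e - e'\<bar>) F \<and> ln (1 / g) \<le> \<eta> * real (card F) \<and> 1 \<le> \<eta> * real (card F))"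

text \<open>The measure bound for a finite \<open>F\<close> is at most \<open>\<eta> * W\<close>
  with \<open>W\<close> depending only on \<open>D\<close> and \<open>r\<close>, so
  \<open>\<eta>\<close> can be chosen after \<open>W\<close> to reach any
  \<open>\<epsilon>\<close>.\<close>

lemma small_set_meeting_copies_if_finely_populated:
  fixes E :: "real set" and D r \<epsilon> :: real
  assumes D: "\<And>e. e \<in> E \<Longrightarrow> \<bar>e\<bar> \<le> D"
    and fine: "finely_populated E"
    and r: "1 \<le> r" and \<epsilon>: "0 < \<epsilon>"
  shows "\<exists>U. U \<in> sets lebesgue \<and> emeasure lebesgue U \<le> ennreal \<epsilon> \<and>
    (\<forall>x c. 1 / r \<le> \<bar>c\<bar> \<and> \<bar>c\<bar> \<le> r \<and> (\<lambda>e. x + c * e) ` E \<subseteq> {0..1} \<longrightarrow> (\<lambda>e. x + c * e) ` E \<inter> U \<noteq> {})"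
proof -
  note fine = fine[unfolded finely_populated_def, rule_format]
  from fine[of 1] obtain e0 where "e0 \<in> E" by auto
  from D[OF this] have D0: "0 \<le> D" by linarith
  define K where "K = nat \<lceil>D + 2\<rceil>"
  define B where "B = nat \<lceil>r * (D + 1) + 2\<rceil>"
  have K: "D + 2 \<le> real K" unfolding K_def by (rule real_nat_ceiling_ge)
  have B: "r * (D + 1) + 2 \<le> real B" unfolding B_def by (rule real_nat_ceiling_ge)
  have "0 \<le> r * (D + 1)" using r D0 by simp
  with B have B2: "2 \<le> real B" by linarith
  define Q where "Q = 8 * real K * (real K + 1)"
  \<comment> \<open>The first summand of \<open>W\<close> comes from the logarithmic term with
    \<open>M \<le> 3 * r / g\<close>, the second from \<open>2 * K / M \<le> K * g\<close>.\<close>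
  define W where "W = Q * (ln (9 * real B * r) + 1) + real K"
  have Q0: "0 \<le> Q" by (simp add: Q_def)
  have "1 * 1 \<le> real B * r" using B2 r by (intro mult_mono) auto
  then have l0: "0 \<le> ln (9 * real B * r)" by (intro ln_ge_zero) simp
  have W0: "0 < W" unfolding W_def using Q0 l0 K D0 by (intro add_nonneg_pos mult_nonneg_nonneg) auto
  define \<eta> where "\<eta> = min 1 (\<epsilon> / W)"
  have \<eta>: "0 < \<eta>" "\<eta> \<le> 1" "\<eta> * W \<le> \<epsilon>"
    using W0 \<epsilon> by (auto simp: \<eta>_def min_def field_simps)
  obtain F g where F: "finite F" "F \<noteq> {}" "F \<subseteq> E" and g: "0 < g" "g \<le> \<eta>"
    and sep: "pairwise (\<lambda>e e'. g \<le> \<bar>e - e'\<bar>) F"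
    and N: "ln (1 / g) \<le> \<eta> * real (card F)" "1 \<le> \<eta> * real (card F)"
    using fine[OF \<eta>(1)] by (elim exE conjE) (rule that; blast)
  have g1: "g \<le> 1" using g \<eta> by linarith
  have cF: "0 < real (card F)" using F by (simp add: card_gt_0_iff)
  define M where "M = nat \<lceil>2 * r / g\<rceil>"
  have M: "2 * r / g \<le> real M" unfolding M_def by (rule real_nat_ceiling_ge)
  have pos: "0 < 2 * r / g" using r g by simp
  then have "real M \<le> 2 * r / g + 1" unfolding M_def by linarith
  moreover have "1 \<le> r / g" using r g g1 by (simp add: field_simps)
  ultimately have M3: "real M \<le> 3 * r / g" by simp
  have M0: "0 < real M" using pos M by linarith
  have DF: "\<forall>e\<in>F. \<bar>e\<bar> \<le> D" using D F(3) by blast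
  obtain U where U: "U \<in> sets lebesgue"
    "emeasure lebesgue U \<le> ennreal (Q * ln (3 * real B * real M) / real (card F) + 2 * real K / real M)"
    "\<forall>x c. 1 / r \<le> \<bar>c\<bar> \<and> \<bar>c\<bar> \<le> r \<and> (\<lambda>e. x + c * e) ` F \<subseteq> {0..1} \<longrightarrow> (\<lambda>e. x + c * e) ` F \<inter> U \<noteq> {}"
    using small_set_meeting_copies[OF F(1,2) DF sep g(1) g1 r M K B, folded Q_def]
    by (elim exE conjE) (rule that; assumption)
  have "ln (3 * real B * real M) \<le> ln (9 * real B * r * (1 / g))"
  proof (subst ln_le_cancel_iff)
    have "3 * real B * real M \<le> 3 * real B * (3 * r / g)" using M3 by (intro mult_left_mono) auto
    then show "3 * real B * real M \<le> 9 * real B * r * (1 / g)" by simp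
  qed (use B2 M0 r g in auto)
  also have "\<dots> = ln (9 * real B * r) + ln (1 / g)" using B2 r g by (subst ln_mult) auto
  also have "\<dots> \<le> ln (9 * real B * r) * (\<eta> * real (card F)) + \<eta> * real (card F)"
    using N l0 mult_left_mono[OF N(2) l0] by linarith
  finally have "ln (3 * real B * real M) / real (card F) \<le> \<eta> * (ln (9 * real B * r) + 1)"
    using cF by (simp add: field_simps)
  then have "Q * (ln (3 * real B * real M) / real (card F)) \<le> Q * (\<eta> * (ln (9 * real B * r) + 1))"
    using Q0 by (rule mult_left_mono)
  moreover have "2 * real K / real M \<le> \<eta> * real K"
  proof -
    have "2 \<le> real M * g" using M r g by (simp add: field_simps)
    also have "\<dots> \<le> real M * \<eta>" using g by (intro mult_left_mono) auto
    finally have "2 * real K \<le> real M * \<eta> * real K" by (rule mult_right_mono) simp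
    then show ?thesis using M0 by (simp add: field_simps)
  qed
  ultimately have "Q * ln (3 * real B * real M) / real (card F) + 2 * real K / real M \<le> \<eta> * W"
    by (simp add: W_def algebra_simps)
  then have "emeasure lebesgue U \<le> ennreal \<epsilon>"
    using U(2) \<eta>(3) by (meson ennreal_leI order_trans)
  moreover have "(\<lambda>e. x + c * e) ` E \<inter> U \<noteq> {}"
    if "1 / r \<le> \<bar>c\<bar>" "\<bar>c\<bar> \<le> r" "(\<lambda>e. x + c * e) ` E \<subseteq> {0..1}" for x c
  proof -
    \<comment> \<open>A copy of \<open>E\<close> inside \<open>{0..1}\<close> contains the
      corresponding copy of \<open>F\<close>, which already meets \<open>U\<close>.\<close>
    have "(\<lambda>e. x + c * e) ` F \<subseteq> (\<lambda>e. x + c * e) ` E" using F(3) by (rule image_mono)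
    with that U(3) show ?thesis by (metis (no_types, lifting) disjoint_iff subset_iff)
  qed
  ultimately show ?thesis using U(1) by (intro exI[of _ U] conjI allI impI) auto
qed

text \<open>The ranges \<open>1 / (n + 1) \<le> \<bar>c\<bar> \<le> n + 1\<close> exhaust all
  nonzero \<open>c\<close>. Removing from \<open>{0..1}\<close> a small set for each range destroys
  every copy of \<open>E\<close>, while the removed measures sum to at most 1/2.\<close>

lemma not_measure_universal_if_finely_populated:
  fixes E :: "real set" and D :: real
  assumes D: "\<And>e. e \<in> E \<Longrightarrow> \<bar>e\<bar> \<le> D"
    and fine: "finely_populated E"
  shows "\<not> measure_universal E"
proof
  assume univ: "measure_universal E"
  have "\<exists>U. U \<in> sets lebesgue \<and> emeasure lebesgue U \<le> ennreal ((1/4) * (1/2) ^ n) \<and>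
    (\<forall>x c. 1 / (real n + 1) \<le> \<bar>c\<bar> \<and> \<bar>c\<bar> \<le> real n + 1 \<and> (\<lambda>e. x + c * e) ` E \<subseteq> {0..1}
      \<longrightarrow> (\<lambda>e. x + c * e) ` E \<inter> U \<noteq> {})" for n
    by (rule small_set_meeting_copies_if_finely_populated[OF D fine]) auto
  then obtain U where U: "\<And>n. U n \<in> sets lebesgue"
    "\<And>n. emeasure lebesgue (U n) \<le> ennreal ((1/4) * (1/2) ^ n)"
    "\<And>n x c. 1 / (real n + 1) \<le> \<bar>c\<bar> \<Longrightarrow> \<bar>c\<bar> \<le> real n + 1 \<Longrightarrow> (\<lambda>e. x + c * e) ` E \<subseteq> {0..1}
      \<Longrightarrow> (\<lambda>e. x + c * e) ` E \<inter> U n \<noteq> {}"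
    by metis
  define L where "L = {0..1} - (\<Union>n. U n)"
  have UU: "(\<Union>n. U n) \<in> sets lebesgue" using U(1) by blast
  have L: "L \<in> sets lebesgue" unfolding L_def using UU by (intro sets.Diff) auto
  have "emeasure lebesgue (\<Union>n. U n) \<le> (\<Sum>n. emeasure lebesgue (U n))"
    using U(1) by (intro emeasure_subadditive_countably) auto
  also have "\<dots> \<le> (\<Sum>n. ennreal ((1/4) * (1/2) ^ n))" by (intro suminf_le U) auto
  also have "\<dots> = ennreal (1/2)"
  proof (rule suminf_ennreal_eq)
    show "(\<lambda>n. (1/4) * (1/2) ^ n :: real) sums (1/2)"
      using sums_mult[OF geometric_sums[of "1/2 :: real"], of "1/4"] by simp
  qed simp
  finally have small: "emeasure lebesgue (\<Union>n. U n) \<le> ennreal (1/2)" .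
  have "emeasure lebesgue L > 0"
  proof (rule ccontr)
    assume "\<not> emeasure lebesgue L > 0"
    then have z: "emeasure lebesgue L = 0" by simp
    have "ennreal 1 = emeasure lebesgue {0..1::real}" by simp
    also have "\<dots> \<le> emeasure lebesgue (L \<union> (\<Union>n. U n))"
      using L UU by (intro emeasure_mono) (auto simp: L_def)
    also have "\<dots> \<le> emeasure lebesgue L + emeasure lebesgue (\<Union>n. U n)"
      using L UU by (rule emeasure_subadditive)
    also have "\<dots> \<le> ennreal (1/2)" using z small by simp
    finally show False by (subst (asm) ennreal_le_iff) auto
  qed
  then obtain x c where c: "c \<noteq> 0" and xc: "(\<lambda>e. x + c * e) ` E \<subseteq> L"
    using univ L unfolding measure_universal_def by blast
  \<comment> \<open>This selects a range of scales that contains \<open>c\<close>.\<close>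
  obtain n where n: "max \<bar>c\<bar> (1 / \<bar>c\<bar>) \<le> real n" using real_arch_simple by blast
  have "1 / \<bar>c\<bar> \<le> real n + 1" using n by simp
  then have "1 / (real n + 1) \<le> \<bar>c\<bar>" using c by (simp add: field_simps)
  moreover have "\<bar>c\<bar> \<le> real n + 1" using n by simp
  ultimately have "(\<lambda>e. x + c * e) ` E \<inter> U n \<noteq> {}"
    using xc by (intro U(3)) (auto simp: L_def)
  with xc show False by (auto simp: L_def)
qed

text \<open>Testing universality on \<open>{0..1}\<close> places an affine copy of \<open>E\<close>
  in a bounded set. This supplies the bound \<open>D\<close> when arguing by contradiction.\<close>

lemma measure_universal_imp_bounded:
  assumes "measure_universal E"
  shows "bounded E"
proof -
  obtain x c where c: "c \<noteq> 0" and xc: "(\<lambda>e. x + c * e) ` E \<subseteq> {0..1}"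
  proof -
    have "{0..1::real} \<in> sets lebesgue" "emeasure lebesgue {0..1::real} > 0" by simp_all
    then show thesis using assms that unfolding measure_universal_def by blast
  qed
  have "E \<subseteq> (\<lambda>y. (y - x) / c) ` {0..1}"
  proof
    fix e assume "e \<in> E"
    then show "e \<in> (\<lambda>y. (y - x) / c) ` {0..1}"
      using c xc by (intro image_eqI[of _ _ "x + c * e"]) auto
  qed
  moreover have "bounded ((\<lambda>y. (y - x) / c) ` {0..1::real})"
    using c by (intro compact_imp_bounded compact_continuous_image continuous_intros) auto
  ultimately show ?thesis by (rule bounded_subset[rotated])
qed

section \<open>Sums with a lacunary sequence are finely populated\<close>

lemma finite_real_set_separated:
  fixes A :: "real set"
  assumes "finite A"
  shows "\<exists>\<gamma>>0. pairwise (\<lambda>a a'. \<gamma> \<le> \<bar>a - a'\<bar>) A"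
proof -
  \<comment> \<open>The extra 1 keeps \<open>Min G\<close> meaningful when \<open>A\<close> has at
    most one point.\<close>
  define G where "G = insert 1 ((\<lambda>(a, a'). \<bar>a - a'\<bar>) ` {p \<in> A \<times> A. fst p \<noteq> snd p})"
  have "finite G" using assms unfolding G_def by simp
  then have "0 < Min G" by (auto simp: G_def)
  moreover have "Min G \<le> \<bar>a - a'\<bar>" if "a \<in> A" "a' \<in> A" "a \<noteq> a'" for a a'
    using that by (intro Min_le \<open>finite G\<close>) (force simp: G_def)
  ultimately show ?thesis by (auto simp: pairwise_def)
qed

text \<open>For fixed \<open>k\<close> points of \<open>A\<close>, both \<open>ln (1 / g)\<close>
  and the number of sums grow linearly in \<open>n\<close>, with slopes \<open>C\<close> and
  \<open>k\<close>. Infinitude of \<open>A\<close> allows \<open>C / k\<close> to be made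
  small.\<close>

lemma lacunary_sum_not_measure_universal:
  fixes A S :: "real set"
  assumes "lacunary b" "neg_log_linear b" and S: "\<And>i. 1 \<le> i \<Longrightarrow> b i \<in> S" and A: "infinite A"
  shows "\<not> measure_universal (S + A)"
proof
  assume univ: "measure_universal (S + A)"
  then have "bounded (S + A)" by (rule measure_universal_imp_bounded)
  then obtain D where D: "\<And>e. e \<in> S + A \<Longrightarrow> \<bar>e\<bar> \<le> D" by (auto simp: bounded_iff)
  obtain q where q: "0 < q" "q < 1" and b0: "\<And>i. 1 \<le> i \<Longrightarrow> 0 < b i"
    and bq: "\<And>i. 1 \<le> i \<Longrightarrow> b (Suc i) \<le> q * b i"
    using assms(1) by (auto simp: lacunary_def lacunary_with_ratio_def)
  obtain C i0 where C: "0 < C" "1 \<le> i0" and ln_b: "\<And>i. i0 \<le> i \<Longrightarrow> - ln (b i) \<le> C * real i"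
    using assms(2) by (auto simp: neg_log_linear_def)
  have b_Suc: "b (Suc i) \<le> b i" if "1 \<le> i" for i
  proof -
    have "q * b i \<le> 1 * b i" using q b0[OF that] by (intro mult_right_mono) auto
    with bq[OF that] show ?thesis by simp
  qed
  have b_antimono: "b j \<le> b i" if "1 \<le> i" "i \<le> j" for i j
    using that(2)
  proof (induction rule: dec_induct)
    case (step n)
    then show ?case using b_Suc[of n] that(1) by linarith
  qed simp
  \<comment> \<open>The iteration starts at \<open>b 1\<close>, the first term covered by
    lacunarity.\<close>
  have b_pow: "b (Suc i) \<le> q ^ i * b 1" for i
  proof (induction i)
    case (Suc i)
    have "b (Suc (Suc i)) \<le> q * b (Suc i)" by (rule bq) simp
    also have "\<dots> \<le> q * (q ^ i * b 1)" using Suc q by (intro mult_left_mono) auto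
    finally show ?case by simp
  qed simp
  have "finely_populated (S + A)"
    unfolding finely_populated_def
  proof (intro allI impI)
    fix \<eta> :: real assume \<eta>: "0 < \<eta>"
    \<comment> \<open>The term \<open>C * n\<close> then takes at most half of the budget
      \<open>\<eta> * k * n\<close>; the other half is left for constants independent of
      \<open>n\<close>.\<close>
    obtain k where k: "max 1 (2 * C / \<eta>) \<le> real k" using real_arch_simple by blast
    then have k1: "1 \<le> real k" and kC: "C \<le> \<eta> * real k / 2"
      using \<eta> by (auto simp: field_simps)
    obtain A' where A': "finite A'" "card A' = k" "A' \<subseteq> A"
      using infinite_arbitrarily_large[OF A] by blast
    obtain \<gamma> where \<gamma>: "0 < \<gamma>" "pairwise (\<lambda>a a'. \<gamma> \<le> \<bar>a - a'\<bar>) A'"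
      using finite_real_set_separated[OF A'(1)] by blast
    have b1: "0 < b 1" by (rule b0) simp
    obtain i2 where i2: "q ^ i2 < \<gamma> / 3 / b 1"
      using real_arch_pow_inv[of "\<gamma> / 3 / b 1" q] \<gamma> b1 q by auto
    \<comment> \<open>From \<open>i1\<close> on, the logarithmic bound holds and the terms are below
      \<open>\<gamma> / 3\<close>, too small to bridge the gaps in \<open>A'\<close>.\<close>
    define i1 where "i1 = max i0 (Suc i2)"
    have i1: "1 \<le> i1" "i0 \<le> i1" using C by (auto simp: i1_def)
    have b_small: "b i < \<gamma> / 3" if "i1 \<le> i" for i
    proof -
      have "b i \<le> b (Suc i2)" using that by (intro b_antimono) (auto simp: i1_def)
      also have "\<dots> \<le> q ^ i2 * b 1" by (rule b_pow)
      also have "\<dots> < \<gamma> / 3" using i2 b1 by (simp add: field_simps)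
      finally show ?thesis .
    qed
    define \<delta> where "\<delta> = min \<eta> (\<gamma> / 3)"
    have \<delta>: "0 < \<delta>" using \<eta> \<gamma> by (simp add: \<delta>_def)
    have \<eta>k: "0 < \<eta> * real k" using \<eta> k1 by simp
    \<comment> \<open>The three lower bounds ensure \<open>g \<le> \<delta>\<close>, room for the
      constants in \<open>ln (1 / g)\<close>, and \<open>1 \<le> \<eta> * k * n\<close>.\<close>
    obtain n where n: "max (- ln \<delta> / C) (max (2 * (ln (1 / (1 - q)) + C * real i1) / (\<eta> * real k)) (1 / (\<eta> * real k))) \<le> real n"
      using real_arch_simple by blast
    then have "- ln \<delta> / C \<le> real n" by simp
    then have n\<delta>: "- ln \<delta> \<le> C * real n" by (simp only: pos_divide_le_eq[OF C(1)] mult.commute)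
    have nq: "ln (1 / (1 - q)) + C * real i1 \<le> \<eta> * real k * real n / 2"
      and n1: "1 \<le> \<eta> * real k * real n"
      using n \<eta>k by (simp_all add: pos_divide_le_eq mult_ac)
    have n0: "0 < n" using n1 by (cases n) auto
    \<comment> \<open>The exponential bounds every selected \<open>b i\<close> from below, and
      \<open>b i - b (Suc i) \<ge> (1 - q) * b i\<close> by lacunarity.\<close>
    define g where "g = (1 - q) * exp (- (C * real (i1 + n)))"
    have g0: "0 < g" using q by (simp add: g_def)
    have "g \<le> 1 * exp (- (C * real (i1 + n)))" unfolding g_def using q by (intro mult_right_mono) auto
    also have "\<dots> \<le> exp (ln \<delta>)"
    proof -
      have "0 \<le> C * real i1" using C by simp
      with n\<delta> show ?thesis by (simp add: distrib_left)
    qed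
    finally have g\<delta>: "g \<le> \<delta>" using \<delta> by simp
    define f where "f = (\<lambda>(i, a). b i + a)"
    define Z where "Z = {i1..<i1 + n} \<times> A'"
    have sep_less: "g \<le> b i - b j" if "i1 \<le> i" "i < j" "i < i1 + n" for i j
    proof -
      have "1 \<le> i" using that i1 by simp
      have "C * real i \<le> C * real (i1 + n)" using that C by (intro mult_left_mono) auto
      moreover have "- ln (b i) \<le> C * real i" using that i1 by (intro ln_b) simp
      ultimately have "exp (- (C * real (i1 + n))) \<le> exp (ln (b i))" by simp
      also have "\<dots> = b i" using b0[OF \<open>1 \<le> i\<close>] by simp
      finally have "g \<le> (1 - q) * b i" unfolding g_def using q by (intro mult_left_mono) auto
      moreover have "b j \<le> b (Suc i)" using that by (intro b_antimono) auto
      moreover have "b (Suc i) \<le> q * b i" using \<open>1 \<le> i\<close> by (rule bq)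
      ultimately show ?thesis by (simp add: algebra_simps)
    qed
    have sep: "g \<le> \<bar>f p - f p'\<bar>" if "p \<in> Z" "p' \<in> Z" "p \<noteq> p'" for p p'
    proof -
      obtain i a j a' where p: "p = (i, a)" "p' = (j, a')" by (cases p, cases p')
      have ij: "i1 \<le> i" "i < i1 + n" "i1 \<le> j" "j < i1 + n" "a \<in> A'" "a' \<in> A'"
        using that by (auto simp: Z_def p)
      show ?thesis
      proof (cases "a = a'")
        case True
        then have "i < j \<or> j < i" using that p by auto
        then show ?thesis using sep_less[of i j] sep_less[of j i] ij True by (auto simp: f_def p)
      next
        case False
        \<comment> \<open>The two \<open>b\<close>-terms differ by less than
          \<open>\<gamma> / 3\<close>, so the sums stay more than \<open>2 * \<gamma> / 3\<close>
          apart.\<close>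
        have "0 < b i" "0 < b j" using ij i1 by (auto intro: b0)
        moreover have "b i < \<gamma> / 3" "b j < \<gamma> / 3" using ij by (intro b_small; simp)+
        moreover have "\<gamma> \<le> \<bar>a - a'\<bar>" using pairwiseD[OF \<gamma>(2)] ij False by blast
        moreover have "g \<le> \<gamma> / 3" using g\<delta> by (simp add: \<delta>_def)
        ultimately show ?thesis unfolding p f_def by auto
      qed
    qed
    \<comment> \<open>Separation was proved for index pairs, so it also shows that no two sums
      coincide and that there are exactly \<open>k * n\<close> of them.\<close>
    have "inj_on f Z"
    proof (rule inj_onI, rule ccontr)
      fix p p' assume "p \<in> Z" "p' \<in> Z" "f p = f p'" "p \<noteq> p'"
      with sep[of p p'] g0 show False by simp
    qed
    then have card: "real (card (f ` Z)) = real k * real n"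
      using A' by (simp add: card_image Z_def card_cartesian_product)
    have "ln (1 / g) = ln (1 / (1 - q)) + C * real (i1 + n)"
      using q unfolding g_def by (simp add: ln_div ln_mult)
    also have "\<dots> \<le> \<eta> * (real k * real n)"
      using nq mult_right_mono[OF kC, of "real n"] by (simp add: algebra_simps)
    finally have ln_g: "ln (1 / g) \<le> \<eta> * real (card (f ` Z))" by (simp add: card)
    show "\<exists>F g. finite F \<and> F \<noteq> {} \<and> F \<subseteq> S + A \<and> 0 < g \<and> g \<le> \<eta> \<and>
      pairwise (\<lambda>e e'. g \<le> \<bar>e - e'\<bar>) F \<and> ln (1 / g) \<le> \<eta> * real (card F) \<and> 1 \<le> \<eta> * real (card F)"
    proof (intro exI conjI)
      show "finite (f ` Z)" using A' by (simp add: Z_def)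
      show "f ` Z \<noteq> {}" using n0 k1 A' by (auto simp: Z_def)
      show "f ` Z \<subseteq> S + A" using S A'(3) i1 by (auto simp: Z_def f_def intro!: set_plus_intro)
      show "g \<le> \<eta>" using g\<delta> by (simp add: \<delta>_def)
      show "1 \<le> \<eta> * real (card (f ` Z))" using n1 by (simp add: card mult_ac)
      show "pairwise (\<lambda>e e'. g \<le> \<bar>e - e'\<bar>) (f ` Z)" using sep by (auto simp: pairwise_def)
    qed (fact g0 ln_g)+
  qed
  with D have "\<not> measure_universal (S + A)" by (rule not_measure_universal_if_finely_populated)
  with univ show False by contradiction
qed

text \<open>Reduces differences to sums, as the reflection of an infinite set is infinite.\<close>

lemma diff_set_eq_plus: "diff_set S A = S + uminus ` A"
  by (force simp: diff_set_def set_plus_def)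

theorem theorem2:
  shows "(\<forall>(S :: real set) (b :: nat \<Rightarrow> real).
            lacunary b \<and> neg_log_linear b \<and> (\<forall>i\<ge>1. b i \<in> S) \<longrightarrow>
            (\<forall>A :: real set. infinite A \<longrightarrow>
               \<not> measure_universal (S + A) \<and> \<not> measure_universal (diff_set S A)))
       \<and> (\<forall>A :: real set. infinite A \<longrightarrow>
            \<not> measure_universal ({2 powi (- int n) | n. n \<ge> 1} + A))"
proof (intro conjI allI impI; (elim conjE)?)
  fix S A :: "real set" and b
  assume b: "lacunary b" "neg_log_linear b" "\<forall>i\<ge>1. b i \<in> S" and A: "infinite A"
  show "\<not> measure_universal (S + A)"
    using b A by (intro lacunary_sum_not_measure_universal) auto
  have "infinite (uminus ` A)" using A by (simp add: finite_image_iff)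
  then show "\<not> measure_universal (diff_set S A)"
    unfolding diff_set_eq_plus using b by (intro lacunary_sum_not_measure_universal) auto
next
  fix A :: "real set" assume A: "infinite A"
  define b :: "nat \<Rightarrow> real" where "b n = 2 powi (- int n)" for n
  have b: "b n = (1/2) ^ n" for n by (simp add: b_def power_int_minus power_one_over inverse_eq_divide)
  have "lacunary b"
    unfolding lacunary_def lacunary_with_ratio_def by (intro exI[of _ "1/2"]) (simp add: b)
  \<comment> \<open>Here \<open>- ln (b i) = i * ln 2\<close>, so \<open>C = ln 2\<close> gives
    equality.\<close>
  moreover have "neg_log_linear b"
    unfolding neg_log_linear_def
    by (intro exI[of _ "ln 2"] conjI exI[of _ 1]) (auto simp: b ln_realpow ln_div)
  ultimately show "\<not> measure_universal ({2 powi (- int n) | n. n \<ge> 1} + A)"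
    using A by (intro lacunary_sum_not_measure_universal[of b]) (auto simp: b_def)
qed
end
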